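(* For each $t\ge0$, define a map $\mathbf{B}_t^M:\Delta_+\to\Delta_+$ by $$\mathbf{B}_t^M(F)=\left(F^{\Box_\vee(1+t)}\right)^{\cup_\vee\frac{1}{1+t}},\qquad F\in\Delta_+.$$ The family $\{\mathbf{B}_t^M\}_{t\ge0}$ is a semigroup with respect to composition, that is, $\mathbf{B}_s^M\circ\mathbf{B}_t^M=\mathbf{B}_{s+t}^M$ for all $s,t\ge0$, and $\alpha(\mathbf{B}_t^M(F))=\alpha(F^{\Box_\vee(1+t)})$ for all $F\in\Delta_+$ and $t\ge0$. In particular, $\mathbf{B}_t^M(F)$ is free regular max-infinitely divisible for any $F\in\Delta_+^{(0)}$ and $t>0$.
   Context: $\Delta_+$ is the set of all (cumulative) distribution functions $F$ of probability measures on $\mathbb{R}$ with $F(x)=0$ for all $x<0$, and $\Delta_+^{(0)}=\{F\in\Delta_+:F(0)=0\}$. For a distribution function $F$, $\alpha(F)=\sup\{x\in\mathbb{R}:F(x)=0\}\in[-\infty,\infty)$. Write $(a)_+=\max\{a,0\}$. For a distribution function $F$ and real $t\ge1$, the free max-convolution power is $F^{\Box_\vee t}(x)=(tF(x)-(t-1))_+$. For $F\in\Delta_+$ and real $t>0$, the Boolean max-convolution power is $F^{\cup_\vee t}=\dfrac{F}{t-(t-1)F}$. A distribution function $F\in\Delta_+^{(0)}$ is free regular max-infinitely divisible if for each $n\in\mathbb{N}$ there is $F_n\in\Delta_+^{(0)}$ such that $F=F_n^{\Box_\vee n}$. *)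

theory Defs
  imports "HOL-Probability.Distribution_Functions"
begin

definition distribution_functions :: "(real \<Rightarrow> real) set" where
  "distribution_functions = {cdf M | M. real_distribution M}"

definition Delta_plus :: "(real \<Rightarrow> real) set" where
  "Delta_plus = {F \<in> distribution_functions. \<forall>x<0. F x = 0}"

definition Delta_plus_0 :: "(real \<Rightarrow> real) set" where
  "Delta_plus_0 = {F \<in> Delta_plus. F 0 = 0}"

(* The supremum is taken in the extended reals, so that it is -\<infinity> if F has no zero. *)
definition alpha :: "(real \<Rightarrow> real) \<Rightarrow> ereal" where
  "alpha F = (SUP x\<in>{x. F x = 0}. ereal x)"

(* Meant for distribution functions F and t \<ge> 1. *)
definition free_max_power :: "(real \<Rightarrow> real) \<Rightarrow> real \<Rightarrow> real \<Rightarrow> real" where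
  "free_max_power F t = (\<lambda>x. max (t * F x - (t - 1)) 0)"

(* Meant for F in Delta_plus and t > 0; the denominator is then at least min t 1,
   hence never zero. *)
definition boolean_max_power :: "(real \<Rightarrow> real) \<Rightarrow> real \<Rightarrow> real \<Rightarrow> real" where
  "boolean_max_power F t = (\<lambda>x. F x / (t - (t - 1) * F x))"

definition free_regular_max_id :: "(real \<Rightarrow> real) \<Rightarrow> bool" where
  "free_regular_max_id F \<longleftrightarrow>
     F \<in> Delta_plus_0 \<and>
     (\<forall>n::nat. n \<ge> 1 \<longrightarrow> (\<exists>F\<^sub>n\<in>Delta_plus_0. F = free_max_power F\<^sub>n (real n)))"

definition B_max :: "real \<Rightarrow> (real \<Rightarrow> real) \<Rightarrow> real \<Rightarrow> real" where
  "B_max t F = boolean_max_power (free_max_power F (1 + t)) (1 / (1 + t))"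

end

theory Submission
  imports Defs
begin

text \<open>
  The map \<open>B_max t\<close> acts on the values of \<open>F\<close>: there is a nondecreasing continuous function
  \<open>\<phi>\<close> of the unit interval onto itself with \<open>B_max t F = \<phi> \<circ> F\<close>. In
  terms of the tail \<open>1 - F\<close>, and away from the zeros of \<open>\<phi>\<close>, it is a translation of the
  reciprocal, \<open>1 / (1 - \<phi> y) = 1 / (1 - y) - t\<close>, cut off where the right-hand side drops
  below \<open>1\<close>, that is, where the new tail would exceed \<open>1\<close> (lemma \<open>B_value_tail\<close>).
  Translations by \<open>t\<close> and then by \<open>s\<close> add up and the cut-offs are compatible, which is the
  semigroup law (\<open>B_value_semigroup\<close>). Composition with \<open>\<phi>\<close> keeps all properties of a
  distribution function on the half-line (\<open>Delta_plus_compose\<close>). The Boolean power multiplies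
  by a positive function, so it leaves the zero set, and with it \<open>alpha\<close>, alone.

  For the last claim, an \<open>n\<close>-th free root of \<open>G\<close> must equal \<open>(G + (n - 1)) / n\<close> wherever
  \<open>G\<close> is positive, and is only bounded by \<open>(n - 1) / n\<close> where \<open>G\<close> vanishes. For \<open>n \<ge> 2\<close>,
  right-continuity thus lets it start from \<open>0\<close> at the origin precisely if \<open>G\<close> vanishes on some
  interval \<open>[0, c]\<close> with \<open>c > 0\<close>; the root may then jump at \<open>c\<close>
  (\<open>free_regular_max_id_if_gap\<close>). Since \<open>F\<close> is right-continuous with \<open>F 0 = 0\<close>, it stays
  below \<open>t / (1 + t)\<close> near \<open>0\<close>, and there \<open>B_max t F\<close> vanishes
  (\<open>B_max_vanishes_near_0\<close>).
\<close>

section \<open>Distribution functions on the half-line\<close>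

lemma Delta_plus_iff:
  "F \<in> Delta_plus \<longleftrightarrow>
     mono F \<and> (\<forall>x. continuous (at_right x) F) \<and> (F \<longlongrightarrow> 1) at_top \<and> (\<forall>x<0. F x = 0)"
proof
  assume "F \<in> Delta_plus"
  then obtain M where M: "real_distribution M" "F = cdf M" and neg: "\<forall>x<0. F x = 0"
    by (auto simp: Delta_plus_def distribution_functions_def)
  interpret real_distribution M by fact
  show "mono F \<and> (\<forall>x. continuous (at_right x) F) \<and> (F \<longlongrightarrow> 1) at_top \<and> (\<forall>x<0. F x = 0)"
    using neg by (auto simp: M(2) monoI cdf_nondecreasing cdf_is_right_cont cdf_lim_at_top_prob)
next
  assume F: "mono F \<and> (\<forall>x. continuous (at_right x) F) \<and> (F \<longlongrightarrow> 1) at_top \<and> (\<forall>x<0. F x = 0)"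
  have "eventually (\<lambda>x. F x = 0) at_bot"
    using F unfolding eventually_at_bot_dense by blast
  then have bot: "(F \<longlongrightarrow> 0) at_bot"
    by (rule tendsto_eventually)
  have "real_distribution (interval_measure F)"
    by (rule real_distribution_interval_measure) (use F bot in \<open>auto dest: monoD\<close>)
  moreover have "cdf (interval_measure F) = F"
    by (rule cdf_interval_measure) (use F bot in \<open>auto dest: monoD\<close>)
  ultimately show "F \<in> Delta_plus"
    using F unfolding Delta_plus_def distribution_functions_def by force
qed

lemma Delta_plus_range:
  assumes "F \<in> Delta_plus"
  shows "F x \<in> {0..1}"
proof -
  obtain M where M: "real_distribution M" "F = cdf M"
    using assms by (auto simp: Delta_plus_def distribution_functions_def)
  interpret real_distribution M by fact
  show ?thesis
    by (simp add: M(2) cdf_nonneg cdf_bounded_prob)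
qed

lemma Delta_plus_compose:
  assumes F: "F \<in> Delta_plus"
    and cont: "continuous_on {0..1} \<phi>" and mono: "mono_on {0..1} \<phi>"
    and ends: "\<phi> 0 = 0" "\<phi> 1 = 1"
  shows "(\<lambda>x. \<phi> (F x)) \<in> Delta_plus"
proof -
  have range: "F x \<in> {0..1}" for x
    using F by (rule Delta_plus_range)
  note props = F[unfolded Delta_plus_iff]
  have lim: "((\<lambda>x. \<phi> (F x)) \<longlongrightarrow> \<phi> l) A" if "(F \<longlongrightarrow> l) A" "l \<in> {0..1}" for l A
    using cont that by (rule continuous_on_tendsto_compose) (use range in auto)
  have "mono (\<lambda>x. \<phi> (F x))"
    using props range mono by (auto intro!: monoI elim!: mono_onD dest: monoD)
  moreover have "\<forall>x. continuous (at_right x) (\<lambda>x. \<phi> (F x))"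
    using props range by (auto simp: continuous_within intro!: lim)
  moreover have "((\<lambda>x. \<phi> (F x)) \<longlongrightarrow> 1) at_top"
    using lim[of 1 at_top] props ends by simp
  ultimately show ?thesis
    using props ends by (auto simp: Delta_plus_iff)
qed

section \<open>The action on values\<close>

definition B_value :: "real \<Rightarrow> real \<Rightarrow> real" where
  "B_value t y = (let g = max ((1 + t) * y - t) 0 in (1 + t) * g / (1 + t * g))"

lemma B_max_eq_B_value:
  assumes "t \<ge> 0"
  shows "B_max t F x = B_value t (F x)"
proof -
  define g where "g = max ((1 + t) * F x - t) 0"
  have "g \<ge> 0" by (simp add: g_def)
  have "1 / (1 + t) - (1 / (1 + t) - 1) * g = (1 + t * g) / (1 + t)"
    using assms by (simp add: field_simps)
  then show ?thesis
    by (simp add: B_max_def boolean_max_power_def free_max_power_def B_value_def Let_def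
        flip: g_def)
qed

lemma B_value_eq_0_iff:
  assumes "t \<ge> 0"
  shows "B_value t y = 0 \<longleftrightarrow> (1 + t) * y \<le> t"
proof -
  define g where "g = max ((1 + t) * y - t) 0"
  have "1 + t * g > 0" using assms by (simp add: g_def add_pos_nonneg)
  then have "B_value t y = 0 \<longleftrightarrow> g = 0"
    using assms by (simp add: B_value_def Let_def g_def[symmetric])
  then show ?thesis by (auto simp: g_def max_def)
qed

text \<open>
  The translation formula for the reciprocal tail, solved for the new value so that it also
  covers \<open>y = 1\<close>, where the reciprocal is infinite.
\<close>
lemma B_value_tail:
  assumes "t \<ge> 0" "(1 + t) * y \<ge> t"
  shows "t * (1 - y) < 1" "B_value t y = 1 - (1 - y) / (1 - t * (1 - y))"
proof -
  have "t * (1 - y) * (1 + t) \<le> t"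
    using mult_left_mono[OF assms(2,1)] by (simp add: algebra_simps)
  also have "t < 1 * (1 + t)" by simp
  finally show pos: "t * (1 - y) < 1"
    using assms by (meson add_nonneg_nonneg mult_right_less_imp_less zero_le_one)
  have "1 + t * ((1 + t) * y - t) = (1 + t) * (1 - t * (1 - y))"
    by (simp add: algebra_simps)
  then have "B_value t y = ((1 + t) * y - t) / (1 - t * (1 - y))"
    using assms by (simp add: B_value_def Let_def)
  also have "\<dots> = 1 - (1 - y) / (1 - t * (1 - y))"
    using pos by (simp add: field_simps)
  finally show "B_value t y = 1 - (1 - y) / (1 - t * (1 - y))" .
qed

lemma continuous_on_B_value: "t \<ge> 0 \<Longrightarrow> continuous_on A (B_value t)"
  unfolding B_value_def Let_def
  by (intro continuous_intros ballI) (smt (verit) max.cobounded2 mult_nonneg_nonneg)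

lemma mono_B_value:
  assumes "t \<ge> 0"
  shows "mono (B_value t)"
proof (rule monoI)
  fix x y :: real
  assume "x \<le> y"
  define g where "g y = max ((1 + t) * y - t) 0" for y
  have "0 \<le> g x"
    by (simp add: g_def)
  have "g x \<le> g y"
    unfolding g_def using assms \<open>x \<le> y\<close> by (intro max.mono) (auto intro: mult_left_mono)
  have "(1 + t) * g x * (1 + t * g y) \<le> (1 + t) * g y * (1 + t * g x)"
    using assms \<open>g x \<le> g y\<close> by (simp add: algebra_simps add_mono mult_left_mono)
  moreover have "1 + t * g x > 0" "1 + t * g y > 0"
    using assms \<open>0 \<le> g x\<close> \<open>g x \<le> g y\<close> by (auto intro: add_pos_nonneg)
  ultimately show "B_value t x \<le> B_value t y"
    by (simp add: B_value_def Let_def g_def[symmetric] frac_le_eq divide_le_eq pos_le_divide_eq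
        divide_simps)
qed

lemma B_value_semigroup:
  assumes s: "s \<ge> 0" and t: "t \<ge> 0" and "y \<le> 1"
  shows "B_value s (B_value t y) = B_value (s + t) y"
proof (cases "(1 + t) * y \<le> t")
  case True
  then have "B_value t y = 0"
    using t by (simp add: B_value_eq_0_iff)
  moreover have "B_value s 0 = 0"
    using s by (simp add: B_value_eq_0_iff)
  moreover have "B_value (s + t) y = 0"
    using s t True \<open>y \<le> 1\<close> mult_left_mono[OF \<open>y \<le> 1\<close> s]
    by (simp add: B_value_eq_0_iff algebra_simps)
  ultimately show ?thesis by simp
next
  case False
  define q where "q = 1 - y"
  define z where "z = B_value t y"
  have q: "t * q < 1" "1 - z = q / (1 - t * q)"
    using B_value_tail[of t y] t False by (auto simp: q_def z_def)
  \<comment> \<open>Both sides are cut off for the same tails: those with \<open>(1 + s + t) * q \<ge> 1\<close>.\<close>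
  have cut_z: "(1 + s) * z \<le> s \<longleftrightarrow> (1 + s) * (1 - z) \<ge> 1"
    by (simp add: algebra_simps)
  have "(1 + s) * (1 - z) \<ge> 1 \<longleftrightarrow> (1 + s + t) * q \<ge> 1"
    unfolding q(2) using q(1) by (simp add: pos_le_divide_eq algebra_simps)
  moreover have "(1 + (s + t)) * y \<le> s + t \<longleftrightarrow> (1 + s + t) * q \<ge> 1"
    by (simp add: q_def algebra_simps)
  ultimately have cut: "(1 + s) * z \<le> s \<longleftrightarrow> (1 + (s + t)) * y \<le> s + t"
    using cut_z by simp
  show ?thesis
  proof (cases "(1 + s) * z \<le> s")
    case True
    then show ?thesis
      using cut s t B_value_eq_0_iff[of s z] B_value_eq_0_iff[of "s + t" y]
      by (simp add: z_def)
  next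
    case False
    have st: "(s + t) * q < 1" "B_value (s + t) y = 1 - q / (1 - (s + t) * q)"
      using B_value_tail[of "s + t" y] s t False cut by (auto simp: q_def)
    have "B_value s z = 1 - (1 - z) / (1 - s * (1 - z))"
      using B_value_tail(2)[of s z] s False by simp
    also have "1 - s * (1 - z) = (1 - (s + t) * q) / (1 - t * q)"
      unfolding q(2) using q(1) by (simp add: field_simps)
    also have "1 - (1 - z) / \<dots> = 1 - q / (1 - (s + t) * q)"
      using q by simp
    finally show ?thesis
      using st by (simp add: z_def)
  qed
qed

section \<open>Free roots\<close>

text \<open>
  A free root of order \<open>n\<close> has to climb to \<open>(n - 1) / n\<close> before \<open>G\<close> becomes positive. Here it
  does so in a single jump at \<open>c\<close>, which leaves it \<open>0\<close> at the origin because \<open>c > 0\<close>.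
\<close>
lemma free_regular_max_id_if_gap:
  assumes G: "G \<in> Delta_plus" and "c > 0" "G c = 0"
  shows "free_regular_max_id G"
proof -
  note props = G[unfolded Delta_plus_iff]
  have range: "0 \<le> G x" "G x \<le> 1" for x
    using Delta_plus_range[OF G, of x] by auto
  have below: "G x = 0" if "x \<le> c" for x
    using props that \<open>G c = 0\<close> range[of x] by (metis antisym monoD)
  have "\<exists>R\<in>Delta_plus_0. G = free_max_power R (real n)" if "n \<ge> 1" for n :: nat
  proof
    define R where "R x = (if x < c then 0 else (G x + (real n - 1)) / real n)" for x
    have n: "real n \<ge> 1" using that by simp
    have "mono R"
      using props n range
      by (auto intro!: monoI simp: R_def divide_right_mono dest: monoD)
    moreover have "continuous (at_right x) R" for x
    proof (cases "x < c")
      case True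
      have "eventually (\<lambda>y. R y = 0) (at_right x)"
        using eventually_at_right_less[of x] True
        by (subst eventually_at_right) (auto simp: R_def)
      then show ?thesis
        using True by (simp add: continuous_within tendsto_eventually R_def)
    next
      case False
      have "((\<lambda>y. (G y + (real n - 1)) / real n) \<longlongrightarrow> (G x + (real n - 1)) / real n) (at_right x)"
        using props n by (intro tendsto_intros) (auto simp: continuous_within)
      moreover have "eventually (\<lambda>y. R y = (G y + (real n - 1)) / real n) (at_right x)"
        using eventually_at_right_less[of x] by eventually_elim (use False in \<open>auto simp: R_def\<close>)
      ultimately show ?thesis
        using False by (simp add: continuous_within R_def cong: filterlim_cong)
    qed
    moreover have "(R \<longlongrightarrow> 1) at_top"
    proof -
      have "((\<lambda>y. (G y + (real n - 1)) / real n) \<longlongrightarrow> (1 + (real n - 1)) / real n) at_top"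
        using props n by (intro tendsto_intros) auto
      moreover have "eventually (\<lambda>y. R y = (G y + (real n - 1)) / real n) at_top"
        using eventually_ge_at_top[of c] by eventually_elim (auto simp: R_def)
      moreover have "(1 + (real n - 1)) / real n = 1"
        using n by simp
      ultimately show ?thesis
        by (simp only: filterlim_cong[OF refl refl])
    qed
    ultimately show "R \<in> Delta_plus_0"
      using \<open>c > 0\<close> by (auto simp: Delta_plus_0_def Delta_plus_iff R_def)
    show "G = free_max_power R (real n)"
      using n range below by (auto simp: free_max_power_def R_def fun_eq_iff max_absorb1)
  qed
  then show ?thesis
    using G below[of 0] \<open>c > 0\<close> by (auto simp: free_regular_max_id_def Delta_plus_0_def)
qed

section \<open>The semigroup\<close>

lemma B_max_Delta_plus:
  assumes "t \<ge> 0" "F \<in> Delta_plus"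
  shows "B_max t F \<in> Delta_plus"
proof -
  have "(\<lambda>x. B_value t (F x)) \<in> Delta_plus"
  proof (rule Delta_plus_compose[where \<phi> = "B_value t"])
    show "mono_on {0..1} (B_value t)"
      using mono_B_value[OF assms(1)] by (auto intro: mono_onI dest: monoD)
    show "B_value t 0 = 0" "B_value t 1 = 1"
      using assms(1) by (auto simp: B_value_def)
  qed (use assms continuous_on_B_value in auto)
  also have "(\<lambda>x. B_value t (F x)) = B_max t F"
    using assms(1) by (simp add: B_max_eq_B_value fun_eq_iff)
  finally show ?thesis .
qed

lemma B_max_vanishes_near_0:
  assumes "F \<in> Delta_plus_0" "t > 0"
  obtains c where "c > 0" "B_max t F c = 0"
proof -
  have "continuous (at_right 0) F" "F 0 = 0"
    using assms(1) by (auto simp: Delta_plus_0_def Delta_plus_iff)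
  then have "(F \<longlongrightarrow> 0) (at_right 0)"
    by (simp add: continuous_within)
  then have "eventually (\<lambda>x. F x < t / (1 + t)) (at_right 0)"
    using assms(2) by (intro order_tendstoD) auto
  then have "eventually (\<lambda>x. 0 < x \<and> F x < t / (1 + t)) (at_right (0::real))"
    using eventually_at_right_less[of 0] by eventually_elim auto
  then obtain c where "0 < c" "F c < t / (1 + t)"
    using eventually_happens trivial_limit_at_right_real by blast
  then have "(1 + t) * F c \<le> t"
    using assms(2) by (simp add: field_simps)
  then show thesis
    using that[of c] \<open>0 < c\<close> assms(2) by (simp add: B_max_eq_B_value B_value_eq_0_iff)
qed

theorem proposition5p2:
  shows "(\<forall>t\<ge>0. B_max t \<in> Delta_plus \<rightarrow> Delta_plus) \<and>
    (\<forall>s\<ge>0. \<forall>t\<ge>0. \<forall>F\<in>Delta_plus. (B_max s \<circ> B_max t) F = B_max (s + t) F) \<and>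
    (\<forall>F\<in>Delta_plus. \<forall>t\<ge>0. alpha (B_max t F) = alpha (free_max_power F (1 + t))) \<and>
    (\<forall>F\<in>Delta_plus_0. \<forall>t>0. free_regular_max_id (B_max t F))"
proof (intro conjI allI impI ballI)
  fix t :: real
  assume "t \<ge> 0"
  then show "B_max t \<in> Delta_plus \<rightarrow> Delta_plus"
    by (auto intro: B_max_Delta_plus)
next
  fix s t :: real and F
  assume "s \<ge> 0" "t \<ge> 0" "F \<in> Delta_plus"
  then show "(B_max s \<circ> B_max t) F = B_max (s + t) F"
    using Delta_plus_range[of F] by (auto simp: fun_eq_iff B_max_eq_B_value B_value_semigroup)
next
  fix F and t :: real
  assume "t \<ge> 0"
  then have "B_max t F x = 0 \<longleftrightarrow> free_max_power F (1 + t) x = 0" for x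
    by (auto simp: B_max_eq_B_value B_value_eq_0_iff free_max_power_def max_def)
  then show "alpha (B_max t F) = alpha (free_max_power F (1 + t))"
    by (simp add: alpha_def)
next
  fix F and t :: real
  assume F: "F \<in> Delta_plus_0" and "t > 0"
  then obtain c where "c > 0" "B_max t F c = 0"
    by (rule B_max_vanishes_near_0)
  moreover have "B_max t F \<in> Delta_plus"
    using F \<open>t > 0\<close> by (intro B_max_Delta_plus) (auto simp: Delta_plus_0_def)
  ultimately show "free_regular_max_id (B_max t F)"
    by (intro free_regular_max_id_if_gap)
qed

end
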